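(* Let $r\geq 2$ and $j\geq 1$ be integers, and let $n$ be a positive integer. Then the following three numbers are equal: (1) the number of partitions of $n$ in which the largest multiple of $r$ occurs exactly $j$ times, i.e. partitions of $n$ having at least one part divisible by $r$ and such that the largest part divisible by $r$ has multiplicity exactly $j$; (2) the number of partitions of $n$ whose smallest $r$-repeating part is $j$; (3) the number of partitions $\lambda$ in $\mathcal{P}_{r-1}^{+}(n)$ with exactly $j$ parts (counted with multiplicity) greater than $\mathrm{maex}(\lambda;r-1)$, the $(r-1)$-chain maximal excludant of $\lambda$.
   Context: A partition $\lambda$ of a positive integer $n$ is a weakly decreasing sequence of positive integers $\lambda=(\lambda_1,\dots,\lambda_\ell)$ (its parts) with sum $n$. $\mathcal{P}(n)$ is the set of partitions of $n$. For a positive integer $s$, $\mathcal{P}_s^0(n)$ is the set of partitions of $n$ in which the gap (difference) between any two successive parts is at most $s$ and the smallest part is at most $s$, and $\mathcal{P}_s^+(n)=\mathcal{P}(n)\setminus\mathcal{P}_s^0(n)$. An $r$-repeating part of a partition is an integer that occurs as a part with multiplicity at least $r$. For a positive integer $s$, the $s$-chain maximal excludant $\mathrm{maex}(\lambda;s)$ of a partition $\lambda$ is the largest positive integer $k$ less than the largest part of $\lambda$ such that $k,k-1,\dots,k-s+1$ are all positive integers and none of them occurs as a part of $\lambda$; if there is no such $k$, then $\mathrm{maex}(\lambda;s)=0$. *)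

theory Defs
  imports Main
begin

text \<open>
  A partition is a weakly decreasing list of positive integers. The largest and smallest part
  are written \<open>Max (set l)\<close> and \<open>Min (set l)\<close>; these are meaningful because a partition of
  a positive integer is nonempty.
\<close>

definition partitions :: "nat \<Rightarrow> nat list set" where
  "partitions n = {l. sorted_wrt (\<ge>) l \<and> (\<forall>x\<in>set l. 0 < x) \<and> sum_list l = n}"

lemma finite_partitions: "finite (partitions n)"
proof (rule finite_subset)
  show "partitions n \<subseteq> {l. set l \<subseteq> {..n} \<and> length l \<le> n}"
  proof
    fix l assume l: "l \<in> partitions n"
    have "length xs \<le> sum_list xs" if "\<forall>x\<in>set xs. 0 < x" for xs :: "nat list"
      using that by (induction xs) auto
    with l show "l \<in> {l. set l \<subseteq> {..n} \<and> length l \<le> n}"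
      by (auto simp: partitions_def intro: member_le_sum_list)
  qed
  show "finite {l. set l \<subseteq> {..n} \<and> length l \<le> n}"
    by (rule finite_lists_length_le) simp
qed

text \<open>The truncated subtraction is the true gap, since parts are weakly decreasing.\<close>

definition gap_bounded_partitions :: "nat \<Rightarrow> nat \<Rightarrow> nat list set" where
  "gap_bounded_partitions s n =
     {l \<in> partitions n. (\<forall>i. Suc i < length l \<longrightarrow> l ! i - l ! Suc i \<le> s) \<and> Min (set l) \<le> s}"

definition gap_unbounded_partitions :: "nat \<Rightarrow> nat \<Rightarrow> nat list set" where
  "gap_unbounded_partitions s n = partitions n - gap_bounded_partitions s n"

definition repeating_parts :: "nat \<Rightarrow> nat list \<Rightarrow> nat set" where
  "repeating_parts r l = {k \<in> set l. r \<le> count_list l k}"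

text \<open>
  The values \<open>k - i\<close> with \<open>i < s\<close> are \<open>k, k - 1, \<dots>, k - s + 1\<close>. Requiring them to be positive
  also excludes any effect of truncated subtraction.
\<close>

definition chain_excludants :: "nat list \<Rightarrow> nat \<Rightarrow> nat set" where
  "chain_excludants l s =
     {k. 0 < k \<and> k < Max (set l) \<and> (\<forall>i<s. 0 < k - i \<and> k - i \<notin> set l)}"

definition maex :: "nat list \<Rightarrow> nat \<Rightarrow> nat" where
  "maex l s = (if chain_excludants l s = {} then 0 else Max (chain_excludants l s))"

end

theory Submission
  imports Defs "HOL-Library.Multiset"
begin

text \<open>
  The second and third numbers agree by conjugation. The gap between the \<open>i\<close>-th and the next part of
  \<open>l\<close> (counting from 1, with a part 0 added at the end) is the multiplicity of \<open>i\<close> in the conjugate of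
  \<open>l\<close>. So a gap of at least \<open>r\<close>, which is what membership in the gap-unbounded partitions
  for \<open>s = r - 1\<close> asks for, is an \<open>r\<close>-repeating part of the conjugate. A run of \<open>r - 1\<close> missing
  positive integers below the largest part lies in such a gap, and the number of parts of \<open>l\<close>
  above the run is the position of the gap, hence that \<open>r\<close>-repeating part (\<open>parts_above_image_chain_excludants\<close>). The
  number of parts above \<open>k\<close> decreases weakly with \<open>k\<close>, so the largest run \<open>maex\<close> gives the smallest
  \<open>r\<close>-repeating part of the conjugate.

  For the first two numbers, split a partition \<open>M\<close> in two ways. Collecting the multiples of \<open>r\<close> gives
  \<open>M = N + r K\<close>, where \<open>N\<close> has no part divisible by \<open>r\<close> and each part of \<open>K\<close> is multiplied by \<open>r\<close>.
  Dividing all multiplicities by \<open>r\<close> with remainder gives \<open>M = N' + K' + \<dots> + K'\<close> (\<open>r\<close> copies), where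
  every multiplicity in \<open>N'\<close> is less than \<open>r\<close>. The first number asks that the largest part of \<open>K\<close>
  occurs \<open>j\<close> times, the second that the smallest part of \<open>K'\<close> is \<open>j\<close>, and conjugation
  exchanges these two conditions. In the sum of \<open>M\<close>, \<open>K\<close> and \<open>K'\<close> each contribute
  \<open>r\<close> times their own sum, so both numbers are convolutions (\<open>card_split\<close>), and it remains to compare the possible \<open>N\<close> and
  \<open>N'\<close>. That they are equally numerous is Glaisher's theorem. It follows from the same two
  splittings with no condition on \<open>K\<close>: both convolutions then count all partitions,
  and a convolution with a sequence starting with 1 can be cancelled
  (\<open>card_regular_eq_card_low_mult\<close>).
\<close>

section \<open>Conjugation of partitions\<close>

text \<open>
  Extending the list by zeros makes the last part, and positions beyond it, no exception in the
  statements about gaps and conjugates.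
\<close>

definition part :: "nat list \<Rightarrow> nat \<Rightarrow> nat" where
  "part l i = (if i < length l then l ! i else 0)"

definition parts_above :: "nat list \<Rightarrow> nat \<Rightarrow> nat" where
  "parts_above l k = length (filter (\<lambda>x. k < x) l)"

definition conjugate :: "nat list \<Rightarrow> nat list" where
  "conjugate l = map (parts_above l) [0..<part l 0]"

lemma part_Cons [simp]: "part (x # l) 0 = x" "part (x # l) (Suc i) = part l i"
  by (auto simp: part_def)

lemma parts_above_Cons: "parts_above (x # l) k = of_bool (k < x) + parts_above l k"
  by (simp add: parts_above_def)

lemma parts_above_antimono: "k \<le> k' \<Longrightarrow> parts_above l k' \<le> parts_above l k"
  by (induction l) (auto simp: parts_above_Cons parts_above_def[of "[]"])

lemma part_le: "(\<And>x. x \<in> set l \<Longrightarrow> x \<le> m) \<Longrightarrow> part l i \<le> m"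
  by (auto simp: part_def)

text \<open>
  Both sides say that the cell in row \<open>i\<close> and column \<open>k\<close> belongs to the Young diagram of \<open>l\<close>. All
  properties of conjugation below are read off from this symmetry.
\<close>

lemma less_parts_above_iff_less_part:
  assumes "sorted_wrt (\<ge>) l"
  shows "i < parts_above l k \<longleftrightarrow> k < part l i"
  using assms
proof (induction l arbitrary: i)
  case Nil
  then show ?case by (simp add: parts_above_def part_def)
next
  case (Cons x l)
  then have IH: "i < parts_above l k \<longleftrightarrow> k < part l i" for i
    by simp
  have le: "part l i \<le> x" for i
    using Cons.prems by (intro part_le) auto
  show ?case
  proof (cases "k < x")
    case True
    then show ?thesis by (cases i) (simp_all add: parts_above_Cons IH)
  next
    case False
    then have "\<not> k < part l i" for i
      using le[of i] by simp
    with IH False show ?thesis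
      by (cases i) (simp_all add: parts_above_Cons)
  qed
qed

lemma part_conjugate:
  assumes "sorted_wrt (\<ge>) l"
  shows "part (conjugate l) i = parts_above l i"
  using less_parts_above_iff_less_part[OF assms, of 0 i]
  by (auto simp: conjugate_def part_def[of "map _ _"])

lemma sorted_conjugate: "sorted_wrt (\<ge>) (conjugate l)"
  by (auto simp: conjugate_def sorted_wrt_iff_nth_less intro: parts_above_antimono)

lemma parts_above_conjugate:
  assumes "sorted_wrt (\<ge>) l"
  shows "parts_above (conjugate l) i = part l i"
proof -
  have "k < parts_above (conjugate l) i \<longleftrightarrow> k < part l i" for k
    using less_parts_above_iff_less_part[OF sorted_conjugate, of k l i]
      less_parts_above_iff_less_part[OF assms, of i k] part_conjugate[OF assms, of k] by simp
  from this[of "part l i"] this[of "parts_above (conjugate l) i"] show ?thesis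
    by simp
qed

lemma pos_conjugate:
  assumes "sorted_wrt (\<ge>) l" "x \<in> set (conjugate l)"
  shows "0 < x"
proof -
  from assms(2) obtain k where "k < part l 0" "x = parts_above l k"
    by (auto simp: conjugate_def)
  then show ?thesis
    using less_parts_above_iff_less_part[OF assms(1), of 0 k] by simp
qed

text \<open>
  Double counting of the cells of the Young diagram.
\<close>

lemma sum_parts_above:
  "(\<And>x. x \<in> set l \<Longrightarrow> x \<le> m) \<Longrightarrow> (\<Sum>k<m. parts_above l k) = sum_list l"
proof (induction l)
  case Nil
  then show ?case by (simp add: parts_above_def)
next
  case (Cons x l)
  have "{..<m} \<inter> {k. k < x} = {..<x}"
    using Cons.prems[of x] by auto
  then have "(\<Sum>k<m. of_bool (k < x)) = x"
    by (simp add: sum.If_cases of_bool_def)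
  with Cons show ?case
    by (simp add: parts_above_Cons sum.distrib)
qed

lemma set_le_part_0:
  assumes "sorted_wrt (\<ge>) l" "x \<in> set l"
  shows "x \<le> part l 0"
  using assms by (cases l) auto

lemma sum_list_conjugate:
  assumes "sorted_wrt (\<ge>) l"
  shows "sum_list (conjugate l) = sum_list l"
  using sum_parts_above[of l "part l 0"] set_le_part_0[OF assms]
  by (simp add: conjugate_def atLeast0LessThan interv_sum_list_conv_sum_set_nat)

lemma list_eq_if_part_eq:
  assumes "\<And>i. part l i = part l' i" "\<forall>x\<in>set l. 0 < x" "\<forall>x\<in>set l'. 0 < x"
  shows "l = l'"
proof -
  have pos: "0 < part xs i \<longleftrightarrow> i < length xs" if "\<forall>x\<in>set xs. 0 < x" for xs i
    using that by (auto simp: part_def)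
  have "i < length l \<longleftrightarrow> i < length l'" for i
    using assms pos by metis
  from this[of "length l"] this[of "length l'"] have "length l = length l'"
    by simp
  then show ?thesis
  proof (rule nth_equalityI)
    fix i assume "i < length l"
    then show "l ! i = l' ! i"
      using assms(1)[of i] \<open>length l = length l'\<close> by (simp add: part_def)
  qed
qed

lemma conjugate_conjugate:
  assumes "l \<in> partitions n"
  shows "conjugate (conjugate l) = l"
proof (rule list_eq_if_part_eq)
  have "sorted_wrt (\<ge>) l"
    using assms by (simp add: partitions_def)
  then show "part (conjugate (conjugate l)) i = part l i" for i
    by (simp add: part_conjugate[OF sorted_conjugate] parts_above_conjugate)
  show "\<forall>x\<in>set (conjugate (conjugate l)). 0 < x"
    using pos_conjugate[OF sorted_conjugate] by blast
  show "\<forall>x\<in>set l. 0 < x"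
    using assms by (simp add: partitions_def)
qed

lemma conjugate_in_partitions: "l \<in> partitions n \<Longrightarrow> conjugate l \<in> partitions n"
  using pos_conjugate[of l] by (simp add: partitions_def sorted_conjugate sum_list_conjugate)

lemma card_partitions_conjugate:
  "card {l \<in> partitions n. P (conjugate l)} = card {l \<in> partitions n. P l}"
proof (rule bij_betw_same_card)
  show "bij_betw conjugate {l \<in> partitions n. P (conjugate l)} {l \<in> partitions n. P l}"
    by (rule bij_betw_byWitness[where f' = conjugate])
      (use conjugate_conjugate[of _ n] conjugate_in_partitions[of _ n] in auto)
qed

lemma count_list_eq_parts_above_diff: "count_list l (Suc k) = parts_above l k - parts_above l (Suc k)"
proof -
  have "count_list l (Suc k) + parts_above l (Suc k) = parts_above l k"
    by (induction l) (auto simp: parts_above_Cons parts_above_def[of "[]"])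
  then show ?thesis by simp
qed

lemma count_list_conjugate:
  assumes "sorted_wrt (\<ge>) l"
  shows "count_list (conjugate l) (Suc i) = part l i - part l (Suc i)"
  using assms by (simp add: count_list_eq_parts_above_diff parts_above_conjugate)

lemma Max_set_eq_part:
  assumes "sorted_wrt (\<ge>) l" "l \<noteq> []"
  shows "Max (set l) = part l 0"
proof (rule Max_eqI)
  show "y \<le> part l 0" if "y \<in> set l" for y
    using set_le_part_0[OF assms(1) that] .
  show "part l 0 \<in> set l"
    using assms(2) by (simp add: part_def)
qed simp

text \<open>
  The last part of the conjugate is the length of the last column of the Young diagram, which meets
  exactly the rows of maximal length.
\<close>

lemma Min_set_conjugate:
  assumes "l \<in> partitions n" "l \<noteq> []"
  shows "Min (set (conjugate l)) = count_list l (Max (set l))"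
proof -
  have s: "sorted_wrt (\<ge>) l" and pos: "0 < part l 0"
    using assms by (auto simp: partitions_def part_def)
  then obtain m where m: "part l 0 = Suc m"
    using gr0_conv_Suc by auto
  have "Min (set (conjugate l)) = parts_above l m"
    by (rule Min_eqI) (auto simp: conjugate_def m parts_above_antimono)
  moreover have "parts_above l (Suc m) = 0"
    using less_parts_above_iff_less_part[OF s, of 0 "Suc m"] m by simp
  ultimately show ?thesis
    using m s assms(2) by (simp add: Max_set_eq_part count_list_eq_parts_above_diff)
qed

section \<open>Chains of missing parts and repeated parts of the conjugate\<close>

lemma repeating_parts_conjugate:
  assumes "l \<in> partitions n" "0 < r"
  shows "repeating_parts r (conjugate l) = Suc ` {i. r \<le> part l i - part l (Suc i)}"
proof -
  have s: "sorted_wrt (\<ge>) l" using assms by (auto simp: partitions_def)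
  have "k \<in> repeating_parts r (conjugate l) \<longleftrightarrow> r \<le> count_list (conjugate l) k" for k
    using assms(2) count_notin[of k "conjugate l"]
    by (cases "k \<in> set (conjugate l)") (auto simp: repeating_parts_def)
  moreover have "count_list (conjugate l) 0 = 0"
    using pos_conjugate[OF s, of 0] by (auto intro: count_notin)
  ultimately show ?thesis
    using assms(2) count_list_conjugate[OF s]
    by (auto simp: image_iff) (metis not0_implies_Suc less_not_refl le_zero_eq)
qed

text \<open>
  The condition on the smallest part is the gap condition at the end of the list, between the
  last part and the 0 that follows it.
\<close>

lemma gap_unbounded_iff_repeating_conjugate:
  assumes l: "l \<in> partitions n" and "0 < n" "0 < r"
  shows "l \<in> gap_unbounded_partitions (r - 1) n \<longleftrightarrow> repeating_parts r (conjugate l) \<noteq> {}"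
proof -
  have s: "sorted_wrt (\<ge>) l" and ne: "l \<noteq> []"
    using assms by (auto simp: partitions_def)
  define m where "m = length l - 1"
  have len: "length l = Suc m" using ne by (simp add: m_def)
  have min: "Min (set l) = part l m"
  proof (rule Min_eqI)
    fix y assume "y \<in> set l"
    then obtain i where "i < length l" "y = l ! i" by (auto simp: in_set_conv_nth)
    then show "part l m \<le> y"
      using s len by (cases "i = m") (auto simp: part_def sorted_wrt_iff_nth_less)
  qed (use len in \<open>auto simp: part_def\<close>)
  have bounded: "(\<forall>i. Suc i < length l \<longrightarrow> l ! i - l ! Suc i \<le> r - 1) \<and> Min (set l) \<le> r - 1 \<longleftrightarrow>
      (\<forall>i. part l i - part l (Suc i) \<le> r - 1)"
  proof (intro iffI allI conjI impI)
    fix i assume H: "(\<forall>i. Suc i < length l \<longrightarrow> l ! i - l ! Suc i \<le> r - 1) \<and> Min (set l) \<le> r - 1"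
    consider "Suc i < length l" | "i = m" | "m < i" using len by linarith
    then show "part l i - part l (Suc i) \<le> r - 1"
      by cases (use H min len in \<open>auto simp: part_def\<close>)
  next
    fix i assume H: "\<forall>i. part l i - part l (Suc i) \<le> r - 1" and "Suc i < length l"
    then show "l ! i - l ! Suc i \<le> r - 1"
      using H[rule_format, of i] by (simp add: part_def)
  next
    assume H: "\<forall>i. part l i - part l (Suc i) \<le> r - 1"
    show "Min (set l) \<le> r - 1"
      using H[rule_format, of m] min len by (simp add: part_def)
  qed
  have "l \<in> gap_unbounded_partitions (r - 1) n \<longleftrightarrow> (\<exists>i. r \<le> part l i - part l (Suc i))"
  proof -
    have "c \<le> r - 1 \<longleftrightarrow> \<not> r \<le> c" for c
      using \<open>0 < r\<close> by linarith
    with bounded l show ?thesis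
      unfolding gap_unbounded_partitions_def gap_bounded_partitions_def by simp
  qed
  then show ?thesis
    using l \<open>0 < r\<close> by (auto simp: repeating_parts_conjugate)
qed

text \<open>
  If \<open>k, \<dots>, k - (r - 2)\<close> are positive and missing, and \<open>Suc i\<close> parts exceed \<open>k\<close>, then the part after
  those is at most \<open>k - (r - 1)\<close>, so the gap there is at least \<open>r\<close>. Conversely, just
  below the upper end of such a gap there is room for \<open>r - 1\<close> consecutive missing integers.
\<close>

lemma parts_above_image_chain_excludants:
  assumes l: "l \<in> partitions n" and "0 < n" and r: "2 \<le> r"
  shows "parts_above l ` chain_excludants l (r - 1) = repeating_parts r (conjugate l)"
proof -
  have s: "sorted_wrt (\<ge>) l" and ne: "l \<noteq> []"
    using assms by (auto simp: partitions_def)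
  note less_iff = less_parts_above_iff_less_part[OF s]
  have max: "Max (set l) = part l 0" using s ne by (rule Max_set_eq_part)
  have part_mem: "part l i = 0 \<or> part l i \<in> set l" for i by (simp add: part_def)
  have mem_part: "\<exists>i. x = part l i" if "x \<in> set l" for x
    using that by (auto simp: in_set_conv_nth part_def)
  have "parts_above l k \<in> Suc ` {i. r \<le> part l i - part l (Suc i)}"
    if k: "k \<in> chain_excludants l (r - 1)" for k
  proof -
    have "0 < parts_above l k"
      using k max less_iff by (simp add: chain_excludants_def)
    then obtain i where i: "parts_above l k = Suc i" using gr0_conv_Suc by auto
    have above: "k < part l i" and below: "part l (Suc i) \<le> k"
      using less_iff[of i k] less_iff[of "Suc i" k] i by auto
    have "part l (Suc i) + (r - 1) \<le> k"
    proof (rule ccontr)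
      assume "\<not> part l (Suc i) + (r - 1) \<le> k"
      then have "k - part l (Suc i) < r - 1" using below by simp
      then have "0 < k - (k - part l (Suc i))" "k - (k - part l (Suc i)) \<notin> set l"
        using k by (auto simp: chain_excludants_def)
      then show False using part_mem[of "Suc i"] below by simp
    qed
    then show ?thesis using above r i by auto
  qed
  moreover have "Suc i \<in> parts_above l ` chain_excludants l (r - 1)"
    if i: "r \<le> part l i - part l (Suc i)" for i
  proof -
    define k where "k = part l i - 1"
    have "part l i \<le> part l 0"
      using part_mem[of i] set_le_part_0[OF s] by auto
    moreover have "k - t \<notin> set l" if "t < r - 1" for t
    proof
      assume "k - t \<in> set l"
      then obtain m where m: "k - t = part l m" using mem_part by auto
      \<comment> \<open>An index \<open>m\<close> with \<open>part l (Suc i) < part l m < part l i\<close> would satisfy \<open>i < m < Suc i\<close>.\<close>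
      have "part l m < part l i" "part l (Suc i) < part l m"
        using i r that by (auto simp: k_def simp flip: m)
      then have "m < parts_above l (part l (Suc i))" "\<not> m < parts_above l (part l m)"
        "i < parts_above l (part l m)" "\<not> Suc i < parts_above l (part l (Suc i))"
        by (auto simp: less_iff)
      then show False by linarith
    qed
    ultimately have "k \<in> chain_excludants l (r - 1)"
      using i r max by (auto simp: chain_excludants_def k_def)
    moreover have "parts_above l k = Suc i"
    proof -
      have "i < parts_above l k" "\<not> Suc i < parts_above l k"
        using i r by (auto simp: less_iff k_def)
      then show ?thesis by simp
    qed
    ultimately show ?thesis by (metis imageI)
  qed
  ultimately show ?thesis
    using l r by (subst repeating_parts_conjugate) auto
qed

text \<open>
  The antitone map \<open>parts_above l\<close> turns the largest chain excludant into the smallest value.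
\<close>

lemma parts_above_maex:
  assumes "l \<in> partitions n" "0 < n" "2 \<le> r" "repeating_parts r (conjugate l) \<noteq> {}"
  shows "parts_above l (maex l (r - 1)) = Min (repeating_parts r (conjugate l))"
proof -
  let ?C = "chain_excludants l (r - 1)"
  have R: "repeating_parts r (conjugate l) = parts_above l ` ?C"
    by (rule parts_above_image_chain_excludants[OF assms(1-3), symmetric])
  have fin: "finite ?C" by (auto simp: chain_excludants_def)
  have ne: "?C \<noteq> {}" using R assms by auto
  show ?thesis
    unfolding R
  proof (rule sym, rule Min_eqI)
    show "parts_above l (maex l (r - 1)) \<in> parts_above l ` ?C"
      using fin ne by (auto simp: maex_def)
  qed (use fin ne in \<open>auto simp: maex_def intro: parts_above_antimono\<close>)
qed

lemma card_maex_eq_card_repeating: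
  assumes "0 < n" "2 \<le> r"
  shows "card {l \<in> gap_unbounded_partitions (r - 1) n.
            length (filter (\<lambda>x. maex l (r - 1) < x) l) = j} =
         card {l \<in> partitions n. repeating_parts r l \<noteq> {} \<and> Min (repeating_parts r l) = j}"
proof -
  have "{l \<in> gap_unbounded_partitions (r - 1) n. parts_above l (maex l (r - 1)) = j} =
      {l \<in> partitions n. repeating_parts r (conjugate l) \<noteq> {} \<and>
         Min (repeating_parts r (conjugate l)) = j}" (is "?L = ?R")
  proof (rule set_eqI)
    fix l
    have "l \<in> gap_unbounded_partitions (r - 1) n \<Longrightarrow> l \<in> partitions n"
      by (simp add: gap_unbounded_partitions_def)
    with assms show "l \<in> ?L \<longleftrightarrow> l \<in> ?R"
      using gap_unbounded_iff_repeating_conjugate[of l n r] parts_above_maex[of l n r] by auto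
  qed
  then show ?thesis
    unfolding parts_above_def
    using card_partitions_conjugate[of n
        "\<lambda>l. repeating_parts r l \<noteq> {} \<and> Min (repeating_parts r l) = j"]
    by simp
qed

section \<open>Partitions as multisets\<close>

definition mpartitions :: "nat \<Rightarrow> nat multiset set" where
  "mpartitions n = {M. 0 \<notin># M \<and> \<Sum>\<^sub># M = n}"

lemma bij_betw_mset_partitions: "bij_betw mset (partitions n) (mpartitions n)"
proof (rule bij_betw_byWitness[where f' = "\<lambda>M. rev (sorted_list_of_multiset M)"])
  show "\<forall>l\<in>partitions n. rev (sorted_list_of_multiset (mset l)) = l"
  proof
    fix l assume "l \<in> partitions n"
    then have "sorted (rev l)" by (simp add: partitions_def sorted_wrt_rev)
    then show "rev (sorted_list_of_multiset (mset l)) = l"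
      using sorted_sort_id[of "rev l"] by (metis mset_rev rev_rev_ident sorted_list_of_multiset_mset)
  qed
  show "mset ` partitions n \<subseteq> mpartitions n"
    by (auto simp: partitions_def mpartitions_def sum_mset_sum_list)
  show "(\<lambda>M. rev (sorted_list_of_multiset M)) ` mpartitions n \<subseteq> partitions n"
  proof clarify
    fix M assume M: "M \<in> mpartitions n"
    have "sum_list (sorted_list_of_multiset M) = n"
      using M sum_mset_sum_list[of "sorted_list_of_multiset M"] by (simp add: mpartitions_def)
    then show "rev (sorted_list_of_multiset M) \<in> partitions n"
      using M by (auto simp: partitions_def mpartitions_def sorted_wrt_rev intro: gr0I)
  qed
qed simp

lemma card_partitions_mset:
  "card {l \<in> partitions n. P (mset l)} = card {M \<in> mpartitions n. P M}"
proof (rule bij_betw_same_card)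
  show "bij_betw mset {l \<in> partitions n. P (mset l)} {M \<in> mpartitions n. P M}"
    using bij_betw_mset_partitions[of n] by (auto simp: bij_betw_def inj_on_def)
qed

lemma finite_mpartitions: "finite (mpartitions n)"
  using bij_betw_finite[OF bij_betw_mset_partitions] finite_partitions by blast

text \<open>
  Conjugation, transported to multisets, where parts can be added and split without sorting.
\<close>

lemma card_mult_Max_eq_card_Min:
  "card {K \<in> mpartitions k. K \<noteq> {#} \<and> count K (Max (set_mset K)) = j} =
   card {K \<in> mpartitions k. K \<noteq> {#} \<and> Min (set_mset K) = j}"
proof -
  have "(l \<noteq> [] \<and> count_list l (Max (set l)) = j) \<longleftrightarrow>
      (conjugate l \<noteq> [] \<and> Min (set (conjugate l)) = j)" if "l \<in> partitions k" for l
  proof -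
    have "conjugate l = [] \<longleftrightarrow> l = []"
      using that by (auto simp: conjugate_def partitions_def part_def)
    then show ?thesis using Min_set_conjugate[OF that] by auto
  qed
  then have "card {l \<in> partitions k. l \<noteq> [] \<and> count_list l (Max (set l)) = j} =
      card {l \<in> partitions k. conjugate l \<noteq> [] \<and> Min (set (conjugate l)) = j}"
    by (metis (no_types, lifting))
  also have "\<dots> = card {l \<in> partitions k. l \<noteq> [] \<and> Min (set l) = j}"
    using card_partitions_conjugate[of k "\<lambda>l. l \<noteq> [] \<and> Min (set l) = j"] .
  finally show ?thesis
    using card_partitions_mset[of k "\<lambda>K. K \<noteq> {#} \<and> count K (Max (set_mset K)) = j"]
      card_partitions_mset[of k "\<lambda>K. K \<noteq> {#} \<and> Min (set_mset K) = j"]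
    by (simp add: count_mset)
qed

section \<open>Splitting off the \<open>r\<close>-fold part of a partition\<close>

text \<open>
  The common form of the two splittings of a partition: \<open>N\<close> ranges over a class \<open>X\<close> of remainders, and
  \<open>f\<close> turns a partition of \<open>k\<close> into one of \<open>r * k\<close>. A property of the sum that depends on \<open>K\<close> alone is
  then counted by a convolution, whose first factor does not depend on the property.
\<close>

lemma card_split:
  fixes f :: "nat multiset \<Rightarrow> nat multiset"
  assumes bij: "bij_betw (\<lambda>(N, K). N + f K) (X \<times> {K. 0 \<notin># K}) {M. 0 \<notin># M}"
    and sum: "\<And>K. \<Sum>\<^sub># (f K) = r * \<Sum>\<^sub># K"
    and PQ: "\<And>N K. N \<in> X \<Longrightarrow> 0 \<notin># K \<Longrightarrow> Q (N + f K) \<longleftrightarrow> P K"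
    and "0 < r"
  shows "card {M \<in> mpartitions n. Q M} =
    (\<Sum>k\<le>n div r. card (X \<inter> mpartitions (n - r * k)) * card {K \<in> mpartitions k. P K})"
proof -
  let ?I = "{..n div r}"
  let ?S = "\<lambda>k. (X \<inter> mpartitions (n - r * k)) \<times> {K \<in> mpartitions k. P K}"
  have I: "k \<le> n div r \<longleftrightarrow> r * k \<le> n" for k
    using \<open>0 < r\<close> by (simp add: less_eq_div_iff_mult_less_eq mult.commute)
  have X0: "0 \<notin># N" if "N \<in> X" for N
  proof -
    have "N + f {#} \<in> {M. 0 \<notin># M}"
      using bij_betw_apply[OF bij, of "(N, {#})"] that by simp
    then show ?thesis by simp
  qed
  have "bij_betw (\<lambda>(N, K). N + f K) (\<Union>k\<in>?I. ?S k) {M \<in> mpartitions n. Q M}"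
    unfolding bij_betw_def
  proof
    show "inj_on (\<lambda>(N, K). N + f K) (\<Union>k\<in>?I. ?S k)"
      by (rule inj_on_subset[OF bij_betw_imp_inj_on[OF bij]]) (auto simp: mpartitions_def)
    show "(\<lambda>(N, K). N + f K) ` (\<Union>k\<in>?I. ?S k) = {M \<in> mpartitions n. Q M}"
    proof (intro equalityI subsetI)
      fix M assume "M \<in> (\<lambda>(N, K). N + f K) ` (\<Union>k\<in>?I. ?S k)"
      then obtain N K k where M: "M = N + f K" and k: "r * k \<le> n" "N \<in> X"
        "N \<in> mpartitions (n - r * k)" "K \<in> mpartitions k" "P K"
        by (auto simp: I)
      have "0 \<notin># M"
        using bij_betw_apply[OF bij, of "(N, K)"] k M by (simp add: mpartitions_def)
      with k M show "M \<in> {M \<in> mpartitions n. Q M}"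
        by (simp add: mpartitions_def sum PQ)
    next
      fix M assume M: "M \<in> {M \<in> mpartitions n. Q M}"
      then have "M \<in> (\<lambda>(N, K). N + f K) ` (X \<times> {K. 0 \<notin># K})"
        using bij_betw_imp_surj_on[OF bij] by (simp add: mpartitions_def)
      then obtain N K where NK: "N \<in> X" "0 \<notin># K" "M = N + f K" by auto
      have n: "n = \<Sum>\<^sub># N + r * \<Sum>\<^sub># K"
        using M NK by (simp add: mpartitions_def sum)
      then have "\<Sum>\<^sub># K \<in> ?I" using I[of "\<Sum>\<^sub># K"] n by simp
      moreover have "(N, K) \<in> ?S (\<Sum>\<^sub># K)"
        using M NK n X0 by (simp add: mpartitions_def PQ)
      ultimately show "M \<in> (\<lambda>(N, K). N + f K) ` (\<Union>k\<in>?I. ?S k)"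
        unfolding NK(3) by (intro image_eqI[where x = "(N, K)"] UN_I) auto
    qed
  qed
  then have "card {M \<in> mpartitions n. Q M} = card (\<Union>k\<in>?I. ?S k)"
    by (rule bij_betw_same_card[symmetric])
  also have "\<dots> = (\<Sum>k\<in>?I. card (?S k))"
  proof (rule card_UN_disjoint)
    show "\<forall>k\<in>?I. finite (?S k)"
      by (simp add: finite_mpartitions)
    show "\<forall>k\<in>?I. \<forall>k'\<in>?I. k \<noteq> k' \<longrightarrow> ?S k \<inter> ?S k' = {}"
      by (auto simp: mpartitions_def)
  qed simp
  finally show ?thesis by (simp add: card_cartesian_product)
qed

lemma sum_mset_image_mult: "\<Sum>\<^sub># (image_mset ((*) r) K) = r * \<Sum>\<^sub># K" for r :: nat
  by (induction K) (simp_all add: algebra_simps)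

lemma sum_mset_repeat_mset: "\<Sum>\<^sub># (repeat_mset r K) = r * \<Sum>\<^sub># K" for K :: "nat multiset"
  by (induction r) simp_all

text \<open>
  Since \<open>r\<close> divides 0, the part 0 is excluded here automatically.
\<close>

definition regular :: "nat \<Rightarrow> nat multiset set" where
  "regular r = {N. \<forall>x\<in>#N. \<not> r dvd x}"

definition low_mult :: "nat \<Rightarrow> nat multiset set" where
  "low_mult r = {N. 0 \<notin># N \<and> (\<forall>x. count N x < r)}"

lemma bij_betw_regular:
  assumes "0 < r"
  shows "bij_betw (\<lambda>(N, K). N + image_mset ((*) r) K) (regular r \<times> {K. 0 \<notin># K}) {M. 0 \<notin># M}"
proof (rule bij_betw_byWitness[where f' = "\<lambda>M. (filter_mset (\<lambda>x. \<not> r dvd x) M,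
    image_mset (\<lambda>x. x div r) (filter_mset ((dvd) r) M))"])
  have *: "filter_mset (\<lambda>x. \<not> r dvd x) N = N" "filter_mset ((dvd) r) N = {#}"
    if "N \<in> regular r" for N
    using that by (auto simp: regular_def filter_mset_eq_conv)
  show "\<forall>a\<in>regular r \<times> {K. 0 \<notin># K}.
       (filter_mset (\<lambda>x. \<not> r dvd x) ((\<lambda>(N, K). N + image_mset ((*) r) K) a),
        image_mset (\<lambda>x. x div r) (filter_mset ((dvd) r) ((\<lambda>(N, K). N + image_mset ((*) r) K) a))) = a"
    using assms by (auto simp: * filter_mset_image_mset multiset.map_comp comp_def)
next
  show "\<forall>M\<in>{M. 0 \<notin># M}. (\<lambda>(N, K). N + image_mset ((*) r) K)
     (filter_mset (\<lambda>x. \<not> r dvd x) M, image_mset (\<lambda>x. x div r) (filter_mset ((dvd) r) M)) = M"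
  proof
    fix M :: "nat multiset"
    have "image_mset ((*) r) (image_mset (\<lambda>x. x div r) (filter_mset ((dvd) r) M)) =
        filter_mset ((dvd) r) M"
      unfolding multiset.map_comp by (rule multiset.map_ident_strong) auto
    then show "(\<lambda>(N, K). N + image_mset ((*) r) K)
     (filter_mset (\<lambda>x. \<not> r dvd x) M, image_mset (\<lambda>x. x div r) (filter_mset ((dvd) r) M)) = M"
      using multiset_partition[of M "(dvd) r"] by (simp add: add.commute)
  qed
next
  show "(\<lambda>(N, K). N + image_mset ((*) r) K) ` (regular r \<times> {K. 0 \<notin># K}) \<subseteq> {M. 0 \<notin># M}"
    using assms by (auto simp: regular_def)
next
  show "(\<lambda>M. (filter_mset (\<lambda>x. \<not> r dvd x) M,
      image_mset (\<lambda>x. x div r) (filter_mset ((dvd) r) M))) ` {M. 0 \<notin># M}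
      \<subseteq> regular r \<times> {K. 0 \<notin># K}"
    using assms by (auto simp: regular_def dvd_div_eq_0_iff)
qed

text \<open>
  Division of every multiplicity by \<open>r\<close> with remainder.
\<close>

lemma bij_betw_low_mult:
  assumes "0 < r"
  shows "bij_betw (\<lambda>(N, K). N + repeat_mset r K) (low_mult r \<times> {K. 0 \<notin># K}) {M. 0 \<notin># M}"
  unfolding bij_betw_def
proof
  show "inj_on (\<lambda>(N, K). N + repeat_mset r K) (low_mult r \<times> {K. 0 \<notin># K})"
  proof (rule inj_onI, clarify)
    fix N K N' K'
    assume N: "N \<in> low_mult r" "N' \<in> low_mult r"
      and eq: "N + repeat_mset r K = N' + repeat_mset r K'"
    have "count N x = count N' x \<and> count K x = count K' x" for x
    proof -
      have lt: "count N x < r" "count N' x < r" using N by (auto simp: low_mult_def)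
      have "count N x + r * count K x = count N' x + r * count K' x"
        using arg_cong[OF eq, of "\<lambda>M. count M x"] by simp
      from arg_cong[OF this, of "\<lambda>c. c mod r"] arg_cong[OF this, of "\<lambda>c. c div r"]
      show ?thesis using lt by simp
    qed
    then show "N = N' \<and> K = K'" by (simp add: multiset_eq_iff)
  qed
  show "(\<lambda>(N, K). N + repeat_mset r K) ` (low_mult r \<times> {K. 0 \<notin># K}) = {M. 0 \<notin># M}"
  proof (intro equalityI subsetI)
    fix M :: "nat multiset" assume "M \<in> {M. 0 \<notin># M}"
    then have 0: "count M 0 = 0" by (simp add: not_in_iff)
    have "finite {x. 0 < count M x mod r} \<and> finite {x. 0 < count M x div r}"
      by (intro conjI; rule finite_subset[OF _ finite_set_mset[of M]])
        (auto simp flip: count_greater_zero_iff intro!: gr0I)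
    then obtain N K where NK: "count N = (\<lambda>x. count M x mod r)" "count K = (\<lambda>x. count M x div r)"
      using count_Abs_multiset[of "\<lambda>x. count M x mod r"] count_Abs_multiset[of "\<lambda>x. count M x div r"]
      by blast
    then have "M = N + repeat_mset r K" by (simp add: multiset_eq_iff)
    moreover have "N \<in> low_mult r" "0 \<notin># K"
      using NK 0 assms by (auto simp: low_mult_def not_in_iff)
    ultimately show "M \<in> (\<lambda>(N, K). N + repeat_mset r K) ` (low_mult r \<times> {K. 0 \<notin># K})"
      by force
  qed (auto simp: low_mult_def not_in_iff)
qed

section \<open>Glaisher's theorem and its refinement\<close>

lemma mpartitions_0: "mpartitions 0 = {{#}}"
  by (auto simp: mpartitions_def) (metis multiset_nonemptyE)

text \<open>
  By induction the terms with \<open>k > 0\<close> of the two convolutions agree, and the totals agree because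
  both count all partitions of \<open>n\<close>. As 0 has one partition, the terms for \<open>k = 0\<close> are the two numbers
  to be compared.
\<close>

lemma card_regular_eq_card_low_mult:
  assumes "0 < r"
  shows "card (regular r \<inter> mpartitions n) = card (low_mult r \<inter> mpartitions n)"
proof (induction n rule: less_induct)
  case (less n)
  let ?a = "\<lambda>m. card (regular r \<inter> mpartitions m)"
  let ?b = "\<lambda>m. card (low_mult r \<inter> mpartitions m)"
  let ?p = "\<lambda>k. card (mpartitions k)"
  let ?I = "{..n div r}"
  have I: "finite ?I" "0 \<in> ?I" by auto
  have smaller: "n - r * k < n" if "k \<in> ?I - {0}" for k
    using that assms div_le_dividend[of n r] by (cases n) auto
  have "(\<Sum>k\<in>?I. ?a (n - r * k) * ?p k) = (\<Sum>k\<in>?I. ?b (n - r * k) * ?p k)"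
    using card_split[OF bij_betw_regular[OF assms], of r "\<lambda>_. True" "\<lambda>_. True" n]
      card_split[OF bij_betw_low_mult[OF assms], of r "\<lambda>_. True" "\<lambda>_. True" n] assms
    by (simp add: sum_mset_image_mult sum_mset_repeat_mset)
  moreover have "(\<Sum>k\<in>?I - {0}. ?a (n - r * k) * ?p k) = (\<Sum>k\<in>?I - {0}. ?b (n - r * k) * ?p k)"
    using smaller less.IH by (intro sum.cong refl) simp
  ultimately show ?case
    using I by (simp add: sum.remove[of _ 0] mpartitions_0)
qed

text \<open>
  In the two splittings, the multiples of \<open>r\<close> in \<open>M\<close> are \<open>r\<close> times the parts of \<open>K\<close>, with the same
  multiplicities, and the \<open>r\<close>-repeating parts of \<open>M\<close> are the parts of \<open>K\<close>. The convolutions that result agree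
  factor by factor.
\<close>

lemma card_Max_multiple_eq_card_repeating:
  assumes "0 < r"
  shows "card {M \<in> mpartitions n. (\<exists>x\<in>#M. r dvd x) \<and> count M (Max {x \<in> set_mset M. r dvd x}) = j} =
    card {M \<in> mpartitions n. {x \<in> set_mset M. r \<le> count M x} \<noteq> {} \<and>
      Min {x \<in> set_mset M. r \<le> count M x} = j}"
    (is "card {M \<in> _. ?Q1 M} = card {M \<in> _. ?Q2 M}")
proof -
  let ?P1 = "\<lambda>K. K \<noteq> {#} \<and> count K (Max (set_mset K)) = j"
  let ?P2 = "\<lambda>K. K \<noteq> {#} \<and> Min (set_mset K) = j"
  have Q1: "?Q1 (N + image_mset ((*) r) K) \<longleftrightarrow> ?P1 K" if "N \<in> regular r" "0 \<notin># K" for N K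
  proof -
    have set: "{x \<in> set_mset (N + image_mset ((*) r) K). r dvd x} = (*) r ` set_mset K"
      using that by (auto simp: regular_def)
    have Max: "Max ((*) r ` set_mset K) = r * Max (set_mset K)" if "K \<noteq> {#}"
      using that by (intro mono_Max_commute[symmetric]) (auto simp: mono_def)
    have cnt: "count (N + image_mset ((*) r) K) (r * x) = count K x" for x
    proof -
      have "r * x \<notin># N" using that by (auto simp: regular_def)
      moreover have "count (image_mset ((*) r) K) (r * x) = count K x"
        using assms by (induction K) auto
      ultimately show ?thesis by (simp add: not_in_iff)
    qed
    have "(\<exists>x\<in>#N + image_mset ((*) r) K. r dvd x) \<longleftrightarrow> K \<noteq> {#}"
    proof -
      have "(\<exists>x\<in>#N + image_mset ((*) r) K. r dvd x) \<longleftrightarrow> (*) r ` set_mset K \<noteq> {}"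
        unfolding set[symmetric] by blast
      then show ?thesis by simp
    qed
    then show ?thesis unfolding set using Max cnt by auto
  qed
  have Q2: "?Q2 (N + repeat_mset r K) \<longleftrightarrow> ?P2 K" if "N \<in> low_mult r" for N K
  proof -
    have "r \<le> count (N + repeat_mset r K) x \<longleftrightarrow> x \<in># K" for x
    proof -
      have "count N x < r" using that by (simp add: low_mult_def)
      then show ?thesis by (cases "count K x") (auto simp: not_in_iff simp flip: count_greater_zero_iff)
    qed
    moreover have "x \<in># N + repeat_mset r K" if "x \<in># K" for x
      using that assms by (simp flip: count_greater_zero_iff)
    ultimately have "{x \<in> set_mset (N + repeat_mset r K). r \<le> count (N + repeat_mset r K) x} = set_mset K"
      by blast
    then show ?thesis by simp
  qed
  show ?thesis
    using card_split[OF bij_betw_regular[OF assms], of r ?Q1 ?P1 n]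
      card_split[OF bij_betw_low_mult[OF assms], of r ?Q2 ?P2 n] Q1 Q2 assms
    by (simp add: sum_mset_image_mult sum_mset_repeat_mset card_mult_Max_eq_card_Min card_regular_eq_card_low_mult)
qed

theorem theorem1p9:
  fixes r j n :: nat
  assumes "2 \<le> r" and "1 \<le> j" and "0 < n"
  shows "card {l \<in> partitions n. (\<exists>x\<in>set l. r dvd x) \<and>
                 count_list l (Max {x \<in> set l. r dvd x}) = j}
           = card {l \<in> partitions n. repeating_parts r l \<noteq> {} \<and> Min (repeating_parts r l) = j}
       \<and> card {l \<in> partitions n. repeating_parts r l \<noteq> {} \<and> Min (repeating_parts r l) = j}
           = card {l \<in> gap_unbounded_partitions (r - 1) n.
                 length (filter (\<lambda>x. maex l (r - 1) < x) l) = j}"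
proof
  have "card {l \<in> partitions n. (\<exists>x\<in>set l. r dvd x) \<and> count_list l (Max {x \<in> set l. r dvd x}) = j}
      = card {M \<in> mpartitions n. (\<exists>x\<in>#M. r dvd x) \<and> count M (Max {x \<in> set_mset M. r dvd x}) = j}"
    by (subst card_partitions_mset[symmetric]) (simp add: count_mset)
  also have "\<dots> = card {M \<in> mpartitions n. {x \<in> set_mset M. r \<le> count M x} \<noteq> {} \<and>
      Min {x \<in> set_mset M. r \<le> count M x} = j}"
    using assms by (intro card_Max_multiple_eq_card_repeating) simp
  also have "\<dots> = card {l \<in> partitions n. repeating_parts r l \<noteq> {} \<and> Min (repeating_parts r l) = j}"
    by (subst card_partitions_mset[symmetric]) (simp add: count_mset repeating_parts_def)
  finally show "card {l \<in> partitions n. (\<exists>x\<in>set l. r dvd x) \<and>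
                 count_list l (Max {x \<in> set l. r dvd x}) = j}
           = card {l \<in> partitions n. repeating_parts r l \<noteq> {} \<and> Min (repeating_parts r l) = j}" .
  show "card {l \<in> partitions n. repeating_parts r l \<noteq> {} \<and> Min (repeating_parts r l) = j}
           = card {l \<in> gap_unbounded_partitions (r - 1) n.
                 length (filter (\<lambda>x. maex l (r - 1) < x) l) = j}"
    using assms by (intro card_maex_eq_card_repeating[symmetric])
qed

end
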